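(* Let $G=(V,E,\gamma)$, $V=[n]$, be a connected undirected weighted graph, $\hat\delta\in\mathbb{R}^n$, and suppose $$\mathcal{U}_{\mathcal S}=\{\delta\in\mathbb{R}^n : |\delta_i-\hat\delta_i|\le\gamma_{ii}\ \forall i\in[n],\ |\delta_i-\delta_j|\le\gamma_{ij}\ \forall\{i,j\}\in E\}$$ is nonempty. Let $\mathcal{Z}\subseteq\mathbb{R}^{n_x}_+\times\mathbb{R}^{n_y}_+$, $C\in\mathbb{R}^{n\times n_x}$ with rows $C_1,\dots,C_n$, $d\in\mathbb{R}^{n_y}$, $c\in\mathbb{R}$. Let $\underline\delta,\bar\delta\in\mathbb{R}^n$ be defined by $$\underline\delta_j=\max_{k\in V}\{\hat\delta_k-\gamma_{kk}-\mathrm{dist}(k,j)\},\qquad \bar\delta_j=\min_{k\in V}\{\hat\delta_k+\gamma_{kk}+\mathrm{dist}(k,j)\},\qquad j\in[n].$$ If $C_jx\le 0$ for all $j\in[n]$ and all $(x,y)\in\mathcal{Z}$, then for $(x,y)\in\mathcal{Z}$ the robust constraint $\delta^\top Cx+d^\top y\le c\ \ \forall\delta\in\mathcal{U}_{\mathcal S}$ is equivalent to $\underline\delta^\top Cx+d^\top y\le c$. Similarly, if $C_jx\ge 0$ for all $j\in[n]$ and all $(x,y)\in\mathcal{Z}$, then for $(x,y)\in\mathcal{Z}$ the robust constraint is equivalent to $\bar\delta^\top Cx+d^\top y\le c$.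
   Context: $[n]=\{1,\dots,n\}$. Weights $\gamma_{ij}=\gamma_{ji}\ge 0$ are given for $\{i,j\}\in E$ (edges join distinct vertices), together with $\gamma_{ii}\ge 0$ for $i\in[n]$. For $i\ne j$, $\mathrm{dist}(i,j)$ is the length of a shortest path between $i$ and $j$ in $G$ with respect to the edge weights $\gamma$, and $\mathrm{dist}(j,j)=0$. *)

theory Defs
  imports
    "HOL-Analysis.Analysis"
    "Graph_Theory.Pair_Digraph"
    "Graph_Theory.Digraph_Component"
    "Graph_Theory.Shortest_Path"
begin

text \<open>
  An undirected graph is a symmetric loop-free digraph (\<^locale>\<open>pair_graph\<close>): the edge \<open>{i, j}\<close>
  is the pair of arcs \<open>(i, j)\<close>, \<open>(j, i)\<close>.  One function \<open>\<gamma>\<close> carries both the edge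
  weights \<open>\<gamma> i j\<close> and the node weights \<open>\<gamma> i i\<close>; its values at other pairs are irrelevant.
\<close>

abbreviation edge_weight :: "('n \<Rightarrow> 'n \<Rightarrow> real) \<Rightarrow> ('n \<times> 'n) weight_fun" where
  "edge_weight \<gamma> \<equiv> (\<lambda>(i, j). \<gamma> i j)"

text \<open>
  \<open>wf_digraph.\<mu>\<close> is an extended-real infimum of walk costs.  On a connected finite graph with
  nonnegative weights it is finite, and is the minimum of the costs of the simple paths; see
  \<open>sp_dist_eq_Min_paths\<close>.
\<close>

definition sp_dist :: "'n pair_pre_digraph \<Rightarrow> ('n \<Rightarrow> 'n \<Rightarrow> real) \<Rightarrow> 'n \<Rightarrow> 'n \<Rightarrow> real" where
  "sp_dist G \<gamma> i j =
     (if i = j then 0 else real_of_ereal (wf_digraph.\<mu> (with_proj G) (edge_weight \<gamma>) i j))"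

lemma sp_dist_eq_Min_paths:
  fixes G :: "'n pair_pre_digraph"
  assumes G: "pair_graph G" "Digraph_Component.connected (with_proj G)"
    and nonneg: "\<And>i j. (i, j) \<in> parcs G \<Longrightarrow> 0 \<le> \<gamma> i j"
    and ij: "i \<in> pverts G" "j \<in> pverts G"
  shows "sp_dist G \<gamma> i j =
    Min (wf_digraph.awalk_cost (edge_weight \<gamma>) ` {p. pre_digraph.apath (with_proj G) i p j})"
proof -
  interpret pair_graph G by fact
  let ?w = "edge_weight \<gamma>"
  let ?P = "{p. apath i p j}"
  have pos: "0 \<le> ?w e" if "e \<in> parcs G" for e
    using nonneg that by (cases e) auto
  have "strongly_connected (with_proj G)"
    using symmetric_connected_imp_strongly_connected sym_arcs G(2) by blast
  then have "i \<rightarrow>\<^sup>*\<^bsub>with_proj G\<^esub> j"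
    using ij by (auto simp: strongly_connected_def)
  then obtain p where p: "apath i p j" "\<mu> ?w i j = awalk_cost ?w p"
    using min_cost_awalk[of i j ?w] pos by auto
  have le: "awalk_cost ?w p \<le> awalk_cost ?w q" if "apath i q j" for q
    using min_cost_le_walk_cost[OF awalkI_apath[OF that], of ?w] p(2) by simp
  have Min_eq: "Min (awalk_cost ?w ` ?P) = awalk_cost ?w p"
    using le p(1) by (intro Min_eqI finite_imageI apaths_finite) auto
  show ?thesis
  proof (cases "i = j")
    case True
    have "apath i [] j"
      using True ij by (simp add: apath_Nil_iff)
    then have "awalk_cost ?w p \<le> 0"
      using le by fastforce
    moreover have "0 \<le> awalk_cost ?w p"
      using pos_cost_pos_awalk_cost[OF awalkI_apath[OF p(1)], of ?w] pos by simp
    ultimately show ?thesis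
      using True Min_eq by (simp add: sp_dist_def)
  next
    case False
    then show ?thesis
      using p(2) Min_eq by (simp add: sp_dist_def)
  qed
qed

definition uncertainty_set ::
  "'n::finite pair_pre_digraph \<Rightarrow> ('n \<Rightarrow> 'n \<Rightarrow> real) \<Rightarrow> real ^ 'n \<Rightarrow> (real ^ 'n) set" where
  "uncertainty_set G \<gamma> \<delta>hat =
     {\<delta>. (\<forall>i. \<bar>\<delta> $ i - \<delta>hat $ i\<bar> \<le> \<gamma> i i) \<and>
         (\<forall>(i, j) \<in> parcs G. \<bar>\<delta> $ i - \<delta> $ j\<bar> \<le> \<gamma> i j)}"

definition delta_lower ::
  "'n::finite pair_pre_digraph \<Rightarrow> ('n \<Rightarrow> 'n \<Rightarrow> real) \<Rightarrow> real ^ 'n \<Rightarrow> real ^ 'n" where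
  "delta_lower G \<gamma> \<delta>hat = (\<chi> j. MAX k. \<delta>hat $ k - \<gamma> k k - sp_dist G \<gamma> k j)"

definition delta_upper ::
  "'n::finite pair_pre_digraph \<Rightarrow> ('n \<Rightarrow> 'n \<Rightarrow> real) \<Rightarrow> real ^ 'n \<Rightarrow> real ^ 'n" where
  "delta_upper G \<gamma> \<delta>hat = (\<chi> j. MIN k. \<delta>hat $ k + \<gamma> k k + sp_dist G \<gamma> k j)"

end

theory Submission
  imports Defs
begin

text \<open>
  The idea is that the uncertainty set has a componentwise least element, namely
  \<^term>\<open>delta_lower G \<gamma> \<delta>hat\<close>, and a componentwise greatest one, \<^term>\<open>delta_upper G \<gamma> \<delta>hat\<close>.
  A linear functional with nonpositive coefficients \<open>C\<^sub>j x\<close> is maximised at the least element, and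
  one with nonnegative coefficients at the greatest, so the worst case in the robust constraint is
  attained at a point that does not depend on \<open>(x, y)\<close>.

  Why the lower vector is the least element: the edge constraints say that \<open>\<delta>\<close> is a potential,
  and summing them along a shortest path gives \<open>\<delta>\<^sub>j \<ge> \<delta>\<^sub>k - dist(k, j)\<close>; with the node constraint at
  \<open>k\<close> this is \<open>\<delta>\<^sub>j \<ge> \<delta>hat\<^sub>k - \<gamma>\<^sub>k\<^sub>k - dist(k, j)\<close> for every \<open>k\<close>, so the maximum over \<open>k\<close> is a lower
  bound (\<open>delta_lower_le\<close>).  The bound is itself feasible (\<open>delta_lower_mem\<close>).  It satisfies the edge
  constraints by the triangle inequality for the distance; the lower node constraint is the choice
  \<open>k = j\<close>; and the upper node constraint is inherited from any feasible point, which is where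
  nonemptiness enters.

  The greatest element is obtained from the least one by the reflection \<open>\<delta> \<mapsto> -\<delta>\<close>, which turns the
  data \<open>\<delta>hat\<close> into \<open>-\<delta>hat\<close> and exchanges the two bounds.
\<close>

section \<open>Shortest-path distance with symmetric nonnegative weights\<close>

locale connected_weighted_graph = pair_graph G
  for G :: "'n::finite pair_pre_digraph" +
  fixes \<gamma> :: "'n \<Rightarrow> 'n \<Rightarrow> real"
  assumes spanning: "pverts G = UNIV"
    and connected_graph: "Digraph_Component.connected (with_proj G)"
    and weight_sym: "(i, j) \<in> parcs G \<Longrightarrow> \<gamma> i j = \<gamma> j i"
    and weight_nonneg: "(i, j) \<in> parcs G \<Longrightarrow> 0 \<le> \<gamma> i j"
begin

lemma sp_dist_attained:
  obtains p where "awalk i p j" "sp_dist G \<gamma> i j = awalk_cost (edge_weight \<gamma>) p"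
proof -
  let ?P = "{p. apath i p j}"
  have "strongly_connected (with_proj G)"
    using symmetric_connected_imp_strongly_connected sym_arcs connected_graph by blast
  then have "i \<rightarrow>\<^sup>*\<^bsub>with_proj G\<^esub> j"
    using spanning by (auto simp: strongly_connected_def)
  then have "?P \<noteq> {}"
    using reachable_apath by auto
  then have "Min (awalk_cost (edge_weight \<gamma>) ` ?P) \<in> awalk_cost (edge_weight \<gamma>) ` ?P"
    by (intro Min_in finite_imageI apaths_finite) auto
  moreover have "sp_dist G \<gamma> i j = Min (awalk_cost (edge_weight \<gamma>) ` ?P)"
    using sp_dist_eq_Min_paths[OF pair_graph_axioms connected_graph] weight_nonneg spanning
    by simp
  ultimately show thesis
    using that awalkI_apath by auto
qed

lemma walk_cost_nonneg:
  assumes "awalk i p j"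
  shows "0 \<le> awalk_cost (edge_weight \<gamma>) p"
  using pos_cost_pos_awalk_cost[OF assms, of "edge_weight \<gamma>"] weight_nonneg by auto

lemma sp_dist_le_walk_cost:
  assumes "awalk i p j"
  shows "sp_dist G \<gamma> i j \<le> awalk_cost (edge_weight \<gamma>) p"
proof (cases "i = j")
  case True
  then show ?thesis
    using walk_cost_nonneg[OF assms] by (simp add: sp_dist_def)
next
  case False
  have "\<mu> (edge_weight \<gamma>) i j \<le> ereal (awalk_cost (edge_weight \<gamma>) p)"
    using min_cost_le_walk_cost[OF assms] .
  \<comment> \<open>The extended-real infimum is attained, hence finite, so the coercion to \<open>real\<close> is monotone here.\<close>
  moreover obtain q where "\<mu> (edge_weight \<gamma>) i j = ereal (awalk_cost (edge_weight \<gamma>) q)"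
    using min_cost_awalk[of i j "edge_weight \<gamma>"] reachable_awalkI[OF assms] weight_nonneg by auto
  ultimately show ?thesis
    using False by (simp add: sp_dist_def)
qed

lemma sp_dist_arc_triangle:
  assumes "(i, j) \<in> parcs G"
  shows "sp_dist G \<gamma> k j \<le> sp_dist G \<gamma> k i + \<gamma> i j"
proof -
  obtain p where p: "awalk k p i" "sp_dist G \<gamma> k i = awalk_cost (edge_weight \<gamma>) p"
    by (rule sp_dist_attained)
  have "awalk i [(i, j)] j"
    using arc_implies_awalk[of "(i, j)"] assms by simp
  with p(1) have "awalk k (p @ [(i, j)]) j"
    by (rule awalk_appendI)
  from sp_dist_le_walk_cost[OF this] show ?thesis
    using p(2) by simp
qed

text \<open>
  The differences of a potential telescope along a walk, so a bound on each arc by its weight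
  bounds the total difference by the cost of the walk.
\<close>

lemma potential_difference_le_walk_cost:
  fixes \<delta> :: "'n \<Rightarrow> real"
  assumes "\<And>i j. (i, j) \<in> parcs G \<Longrightarrow> \<delta> i - \<delta> j \<le> \<gamma> i j"
    and "awalk k p j"
  shows "\<delta> k - \<delta> j \<le> awalk_cost (edge_weight \<gamma>) p"
  using assms(2)
proof (induction p arbitrary: k)
  case Nil
  then show ?case by (simp add: awalk_Nil_iff)
next
  case (Cons e p)
  obtain u v where e: "e = (u, v)" by (cases e)
  with Cons.prems have *: "u = k" "(k, v) \<in> parcs G" "awalk v p j"
    by (auto simp: awalk_Cons_iff)
  then show ?case
    using Cons.IH[OF *(3)] assms(1)[OF *(2)] e by simp
qed

lemma potential_difference_le_sp_dist:
  fixes \<delta> :: "'n \<Rightarrow> real"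
  assumes "\<And>i j. (i, j) \<in> parcs G \<Longrightarrow> \<delta> i - \<delta> j \<le> \<gamma> i j"
  shows "\<delta> k - \<delta> j \<le> sp_dist G \<gamma> k j"
  using sp_dist_attained[of k j] potential_difference_le_walk_cost[OF assms] by metis

section \<open>The least and the greatest element of the uncertainty set\<close>

lemma delta_lower_ge: "\<delta>hat $ k - \<gamma> k k - sp_dist G \<gamma> k j \<le> delta_lower G \<gamma> \<delta>hat $ j"
  by (simp add: delta_lower_def)

lemma delta_lower_le:
  assumes "\<delta> \<in> uncertainty_set G \<gamma> \<delta>hat"
  shows "delta_lower G \<gamma> \<delta>hat $ j \<le> \<delta> $ j"
proof -
  have "\<delta>hat $ k - \<gamma> k k - sp_dist G \<gamma> k j \<le> \<delta> $ j" for k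
  proof -
    have "\<delta> $ k - \<delta> $ j \<le> sp_dist G \<gamma> k j"
      using assms by (intro potential_difference_le_sp_dist) (fastforce simp: uncertainty_set_def)
    moreover have "\<bar>\<delta> $ k - \<delta>hat $ k\<bar> \<le> \<gamma> k k"
      using assms by (simp add: uncertainty_set_def)
    ultimately show ?thesis by linarith
  qed
  then show ?thesis by (simp add: delta_lower_def)
qed

text \<open>
  Moving from \<open>i\<close> to a neighbour \<open>j\<close> lengthens each distance by at most \<open>\<gamma> i j\<close>, so each of
  the terms in the maximum drops by at most that much.
\<close>

lemma delta_lower_arc:
  assumes "(i, j) \<in> parcs G"
  shows "delta_lower G \<gamma> \<delta>hat $ i - delta_lower G \<gamma> \<delta>hat $ j \<le> \<gamma> i j"
proof -
  have "\<delta>hat $ k - \<gamma> k k - sp_dist G \<gamma> k i \<le> delta_lower G \<gamma> \<delta>hat $ j + \<gamma> i j" for k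
    using sp_dist_arc_triangle[OF assms, of k] delta_lower_ge[of \<delta>hat k j] by linarith
  then have "delta_lower G \<gamma> \<delta>hat $ i \<le> delta_lower G \<gamma> \<delta>hat $ j + \<gamma> i j"
    by (simp add: delta_lower_def[of _ _ \<delta>hat])
  then show ?thesis by simp
qed

lemma delta_lower_mem:
  assumes "uncertainty_set G \<gamma> \<delta>hat \<noteq> {}"
  shows "delta_lower G \<gamma> \<delta>hat \<in> uncertainty_set G \<gamma> \<delta>hat"
proof -
  let ?l = "delta_lower G \<gamma> \<delta>hat"
  obtain \<delta> where \<delta>: "\<delta> \<in> uncertainty_set G \<gamma> \<delta>hat"
    using assms by blast
  have "\<bar>?l $ i - \<delta>hat $ i\<bar> \<le> \<gamma> i i" for i
  proof -
    have "\<delta>hat $ i - \<gamma> i i \<le> ?l $ i"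
      using delta_lower_ge[of \<delta>hat i i] by (simp add: sp_dist_def)
    moreover have "\<bar>\<delta> $ i - \<delta>hat $ i\<bar> \<le> \<gamma> i i"
      using \<delta> by (simp add: uncertainty_set_def)
    ultimately show ?thesis
      using delta_lower_le[OF \<delta>, of i] by linarith
  qed
  moreover have "\<bar>?l $ i - ?l $ j\<bar> \<le> \<gamma> i j" if "(i, j) \<in> parcs G" for i j
  proof -
    have "(j, i) \<in> parcs G"
      using that arcs_symmetric by blast
    from delta_lower_arc[OF this] delta_lower_arc[OF that] show ?thesis
      using weight_sym[OF that] by (smt (verit))
  qed
  ultimately show ?thesis
    by (auto simp: uncertainty_set_def)
qed

end

lemma uncertainty_set_uminus:
  "- \<delta> \<in> uncertainty_set G \<gamma> (- \<delta>hat) \<longleftrightarrow> \<delta> \<in> uncertainty_set G \<gamma> \<delta>hat"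
  by (simp add: uncertainty_set_def abs_minus_commute)

lemma delta_lower_uminus: "delta_lower G \<gamma> (- \<delta>hat) = - delta_upper G \<gamma> \<delta>hat"
proof -
  have "(MAX k. (- \<delta>hat) $ k - \<gamma> k k - sp_dist G \<gamma> k j)
      = - (MIN k. \<delta>hat $ k + \<gamma> k k + sp_dist G \<gamma> k j)" for j
    by (subst minus_Min_eq_Max) (auto simp: image_image algebra_simps)
  then show ?thesis
    by (simp add: delta_lower_def delta_upper_def vec_eq_iff)
qed

context connected_weighted_graph
begin

lemma delta_upper_ge:
  assumes "\<delta> \<in> uncertainty_set G \<gamma> \<delta>hat"
  shows "\<delta> $ j \<le> delta_upper G \<gamma> \<delta>hat $ j"
  using delta_lower_le[of "- \<delta>" "- \<delta>hat" j] assms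
  by (simp add: uncertainty_set_uminus delta_lower_uminus)

lemma delta_upper_mem:
  assumes "uncertainty_set G \<gamma> \<delta>hat \<noteq> {}"
  shows "delta_upper G \<gamma> \<delta>hat \<in> uncertainty_set G \<gamma> \<delta>hat"
proof -
  have "uncertainty_set G \<gamma> (- \<delta>hat) \<noteq> {}"
    using assms uncertainty_set_uminus by blast
  from delta_lower_mem[OF this] show ?thesis
    by (simp add: uncertainty_set_uminus delta_lower_uminus)
qed

end

section \<open>Worst cases of a linear constraint\<close>

lemma linear_constraint_iff_at_least:
  fixes m v :: "real ^ 'n"
  assumes "m \<in> U" "\<And>\<delta> j. \<delta> \<in> U \<Longrightarrow> m $ j \<le> \<delta> $ j" "\<And>j. v $ j \<le> 0"
  shows "(\<forall>\<delta>\<in>U. \<delta> \<bullet> v + t \<le> c) \<longleftrightarrow> m \<bullet> v + t \<le> c"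
proof -
  have "\<delta> \<bullet> v \<le> m \<bullet> v" if "\<delta> \<in> U" for \<delta>
    using assms(2)[OF that] assms(3) by (auto simp: inner_vec_def intro!: sum_mono mult_right_mono_neg)
  then show ?thesis using assms(1) by force
qed

lemma linear_constraint_iff_at_greatest:
  fixes m v :: "real ^ 'n"
  assumes "m \<in> U" "\<And>\<delta> j. \<delta> \<in> U \<Longrightarrow> \<delta> $ j \<le> m $ j" "\<And>j. 0 \<le> v $ j"
  shows "(\<forall>\<delta>\<in>U. \<delta> \<bullet> v + t \<le> c) \<longleftrightarrow> m \<bullet> v + t \<le> c"
proof -
  have "\<delta> \<bullet> v \<le> m \<bullet> v" if "\<delta> \<in> U" for \<delta>
    using assms(2)[OF that] assms(3) by (auto simp: inner_vec_def intro!: sum_mono mult_right_mono)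
  then show ?thesis using assms(1) by force
qed

theorem proposition12:
  fixes G :: "'n::finite pair_pre_digraph"
    and \<gamma> :: "'n \<Rightarrow> 'n \<Rightarrow> real"
    and \<delta>hat :: "real ^ 'n"
    and Z :: "((real ^ 'nx) \<times> (real ^ 'ny)) set"
    and C :: "real ^ 'nx ^ 'n"
    and d :: "real ^ 'ny"
    and c :: real
  assumes graph: "pair_graph G" "pverts G = UNIV" "Digraph_Component.connected (with_proj G)"
    and edge_weights: "\<And>i j. (i, j) \<in> parcs G \<Longrightarrow> \<gamma> i j = \<gamma> j i \<and> 0 \<le> \<gamma> i j"
    and node_weights: "\<And>i. 0 \<le> \<gamma> i i"
    and nonempty: "uncertainty_set G \<gamma> \<delta>hat \<noteq> {}"
    and Z_nonneg: "Z \<subseteq> {x. \<forall>i. 0 \<le> x $ i} \<times> {y. \<forall>i. 0 \<le> y $ i}"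
  shows "((\<forall>(x, y)\<in>Z. \<forall>j. row j C \<bullet> x \<le> 0) \<longrightarrow>
           (\<forall>(x, y)\<in>Z.
             (\<forall>\<delta>\<in>uncertainty_set G \<gamma> \<delta>hat. \<delta> \<bullet> (C *v x) + d \<bullet> y \<le> c) \<longleftrightarrow>
             delta_lower G \<gamma> \<delta>hat \<bullet> (C *v x) + d \<bullet> y \<le> c)) \<and>
         ((\<forall>(x, y)\<in>Z. \<forall>j. 0 \<le> row j C \<bullet> x) \<longrightarrow>
           (\<forall>(x, y)\<in>Z.
             (\<forall>\<delta>\<in>uncertainty_set G \<gamma> \<delta>hat. \<delta> \<bullet> (C *v x) + d \<bullet> y \<le> c) \<longleftrightarrow>
             delta_upper G \<gamma> \<delta>hat \<bullet> (C *v x) + d \<bullet> y \<le> c))"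
proof -
  interpret pair_graph G by (rule graph)
  interpret connected_weighted_graph G \<gamma>
    using graph edge_weights by unfold_locales auto
  have row: "(C *v x) $ j = row j C \<bullet> x" for x j
    by (simp add: matrix_vector_mul_component row_def vec_nth_inverse)
  show ?thesis
  proof (intro conjI impI ballI; clarify)
    fix x y
    assume "(x, y) \<in> Z" "\<forall>(x, y)\<in>Z. \<forall>j. row j C \<bullet> x \<le> 0"
    then show "(\<forall>\<delta>\<in>uncertainty_set G \<gamma> \<delta>hat. \<delta> \<bullet> (C *v x) + d \<bullet> y \<le> c) \<longleftrightarrow>
        delta_lower G \<gamma> \<delta>hat \<bullet> (C *v x) + d \<bullet> y \<le> c"
      using delta_lower_mem[OF nonempty] delta_lower_le
      by (intro linear_constraint_iff_at_least) (auto simp: row)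
  next
    fix x y
    assume "(x, y) \<in> Z" "\<forall>(x, y)\<in>Z. \<forall>j. 0 \<le> row j C \<bullet> x"
    then show "(\<forall>\<delta>\<in>uncertainty_set G \<gamma> \<delta>hat. \<delta> \<bullet> (C *v x) + d \<bullet> y \<le> c) \<longleftrightarrow>
        delta_upper G \<gamma> \<delta>hat \<bullet> (C *v x) + d \<bullet> y \<le> c"
      using delta_upper_mem[OF nonempty] delta_upper_ge
      by (intro linear_constraint_iff_at_greatest) (auto simp: row)
  qed
qed

end
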